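(* Let $u\in\Omega\neq\emptyset$, $c_u\geq\lVert x_0-u\rVert^2$, and let $M>0$ with $M\geq\lVert\xi_n\rVert$ for all $n\in\mathbb{N}$. Let $\lambda_n\in[a,b]\subseteq(0,2/M^2)$ for all $n\in\mathbb{N}$. Then for all $k\in\mathbb{N}$ and all $g:\mathbb{N}\to\mathbb{N}$: \[ \exists n\leq\Phi_2(k^2+2k,g,c_u)\ \forall i\in[n;n+g(n)]\ \left(f(y_i,x_i)<\frac1{k+1}\right), \] where \[ \Phi_2(k,g,c_u):=\Phi_1\left(\left\lceil\frac{k+1}{\alpha(a,b,M)}\right\rceil-1,\,g+1,\,c_u\right),\qquad \alpha(a,b,M):=-a(M^2b-2), \] $g+1$ denotes the function $n\mapsto g(n)+1$, and for $h:\mathbb{N}\to\mathbb{N}$, \[ \Phi_1(k,h,c_u):=\tilde h^{(\lceil c_u(k+1)\rceil)}(0),\qquad \tilde h(n):=n+h(n), \] with $\tilde h^{(m)}(0)$ the $m$-th iterate of $\tilde h$ starting from $0$.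
   Context: Notation: $\mathbb{N}=\{0,1,2,\dots\}$, $[n;m]:=\{n,n+1,\dots,m\}$. $\mathbb{R}^N$ ($N\geq1$) carries the Euclidean inner product and norm; $\overline{B_r(x)}$ is the closed ball. Setting: $f:\mathbb{R}^N\times\mathbb{R}^N\to\mathbb{R}$ satisfies: $f(x,x)=0$ for all $x$; $f(\cdot,y)$ is continuous for every $y$; $f(x,\cdot)$ is convex for every $x$. $T:\mathbb{R}^N\to\mathbb{R}^N$ is firmly nonexpansive, i.e. $\lVert Tx-Ty\rVert^2\leq\langle x-y,Tx-Ty\rangle$ for all $x,y$, with nonempty fixed point set $\mathrm{Fix}(T)$. The sequences are generated by the following algorithm: $x_0\in\mathbb{R}^N$ is arbitrary, $\rho_0:=\lVert x_0\rVert$. Given $x_n$ and $\rho_n$, choose $\varepsilon_n\geq0$ and $\lambda_n>0$; take $y_n\in K_n:=\overline{B_{\rho_n+1}(0)}$ with $f(y_n,x_n)\geq0$ and $\max_{y\in K_n}f(y,x_n)\leq f(y_n,x_n)+\varepsilon_n$; choose any $\xi_n\in\partial f(y_n,\cdot)(x_n)$ (subdifferential of the convex function $f(y_n,\cdot)$ at $x_n$); set $x_{n+1}:=T(x_n-\lambda_nf(y_n,x_n)\xi_n)$ and $\rho_{n+1}:=\max\{\rho_n,\lVert x_{n+1}\rVert\}$. $\Omega_n:=\{u\in\mathrm{Fix}(T)\mid f(y_n,u)\leq0\}$ and $\Omega:=\bigcap_{n\in\mathbb{N}}\Omega_n$. *)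

theory Defs
  imports "HOL-Analysis.Analysis"
begin

definition firmly_nonexpansive :: "('a::real_inner \<Rightarrow> 'a) \<Rightarrow> bool" where
  "firmly_nonexpansive T \<longleftrightarrow>
     (\<forall>x y. (norm (T x - T y))\<^sup>2 \<le> (x - y) \<bullet> (T x - T y))"

definition Fix :: "('a \<Rightarrow> 'a) \<Rightarrow> 'a set" where
  "Fix T = {u. T u = u}"

definition subdifferential :: "('a::real_inner \<Rightarrow> real) \<Rightarrow> 'a \<Rightarrow> 'a set" where
  "subdifferential h x = {\<xi>. \<forall>z. h z \<ge> h x + \<xi> \<bullet> (z - x)}"

text \<open>The algorithm does not determine its sequences uniquely, so it is rendered as a
  predicate on them.  The supremum below is a maximum whenever \<open>f(\<cdot>, y)\<close> is continuous,
  see \<open>SUP_cball_attained\<close>.\<close>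

definition generated_by_algorithm ::
  "('a::euclidean_space \<Rightarrow> 'a \<Rightarrow> real) \<Rightarrow> ('a \<Rightarrow> 'a) \<Rightarrow> (nat \<Rightarrow> 'a) \<Rightarrow> (nat \<Rightarrow> real) \<Rightarrow>
   (nat \<Rightarrow> real) \<Rightarrow> (nat \<Rightarrow> real) \<Rightarrow> (nat \<Rightarrow> 'a) \<Rightarrow> (nat \<Rightarrow> 'a) \<Rightarrow> bool" where
  "generated_by_algorithm f T x \<rho> \<epsilon> lam y \<xi> \<longleftrightarrow>
     \<rho> 0 = norm (x 0) \<and>
     (\<forall>n. \<epsilon> n \<ge> 0 \<and> lam n > 0 \<and>
          y n \<in> cball 0 (\<rho> n + 1) \<and>
          f (y n) (x n) \<ge> 0 \<and>
          (SUP z\<in>cball 0 (\<rho> n + 1). f z (x n)) \<le> f (y n) (x n) + \<epsilon> n \<and>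
          \<xi> n \<in> subdifferential (f (y n)) (x n) \<and>
          x (Suc n) = T (x n - (lam n * f (y n) (x n)) *\<^sub>R \<xi> n) \<and>
          \<rho> (Suc n) = max (\<rho> n) (norm (x (Suc n))))"

lemma SUP_cball_attained:
  fixes h :: "'a::euclidean_space \<Rightarrow> real"
  assumes "continuous_on UNIV h" "r \<ge> 0"
  shows "\<exists>z\<in>cball 0 r. (\<forall>w\<in>cball 0 r. h w \<le> h z) \<and> (SUP w\<in>cball 0 r. h w) = h z"
proof -
  have "continuous_on (cball 0 r) h"
    using assms(1) continuous_on_subset by blast
  moreover have "cball (0::'a) r \<noteq> {}"
    using assms(2) by simp
  ultimately obtain z where z: "z \<in> cball 0 r" "\<forall>w\<in>cball 0 r. h w \<le> h z"
    using continuous_attains_sup[OF compact_cball] by blast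
  then have "(SUP w\<in>cball 0 r. h w) = h z"
    by (intro cSup_eq_maximum) auto
  with z show ?thesis by blast
qed

definition Omega_n :: "('a \<Rightarrow> 'a \<Rightarrow> real) \<Rightarrow> ('a \<Rightarrow> 'a) \<Rightarrow> (nat \<Rightarrow> 'a) \<Rightarrow> nat \<Rightarrow> 'a set" where
  "Omega_n f T y n = {u \<in> Fix T. f (y n) u \<le> 0}"

definition Omega :: "('a \<Rightarrow> 'a \<Rightarrow> real) \<Rightarrow> ('a \<Rightarrow> 'a) \<Rightarrow> (nat \<Rightarrow> 'a) \<Rightarrow> 'a set" where
  "Omega f T y = (\<Inter>n. Omega_n f T y n)"

definition alpha :: "real \<Rightarrow> real \<Rightarrow> real \<Rightarrow> real" where
  "alpha a b M = - a * (M\<^sup>2 * b - 2)"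

definition Phi1 :: "nat \<Rightarrow> (nat \<Rightarrow> nat) \<Rightarrow> real \<Rightarrow> nat" where
  "Phi1 k h c = ((\<lambda>n. n + h n) ^^ nat \<lceil>c * (real k + 1)\<rceil>) 0"

text \<open>The truncating subtraction in \<open>Phi2\<close> is harmless: \<open>alpha a b M > 0\<close> in the range of
  parameters considered, so the ceiling is at least 1.\<close>

definition Phi2 :: "real \<Rightarrow> real \<Rightarrow> real \<Rightarrow> nat \<Rightarrow> (nat \<Rightarrow> nat) \<Rightarrow> real \<Rightarrow> nat" where
  "Phi2 a b M k g c = Phi1 (nat \<lceil>(real k + 1) / alpha a b M\<rceil> - 1) (\<lambda>n. g n + 1) c"

end

theory Submission
  imports Defs
begin

text \<open>Before \<open>T\<close> is applied, a step of the algorithm is a relaxed projection of \<open>x n\<close> onto a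
  half-space containing \<open>u\<close>: since \<open>\<xi> n\<close> is a subgradient of \<open>f (y n)\<close> at \<open>x n\<close> and \<open>f (y n) u \<le> 0\<close>,
  the direction \<open>- \<xi> n\<close> points towards \<open>u\<close> with inner product at least \<open>f (y n) (x n)\<close>.
  Expanding the square, and using that \<open>T\<close> is nonexpansive and fixes \<open>u\<close>, gives the
  quantitative Fejer inequality
  \<open>alpha a b M * (f (y n) (x n))\<^sup>2 \<le> (norm (x n - u))\<^sup>2 - (norm (x (Suc n) - u))\<^sup>2\<close>
  (\<open>subgradient_step_decrease\<close>).

  So the squared distances to \<open>u\<close> form a nonincreasing sequence in \<open>[0, c\<^sub>u]\<close>, and the values
  \<open>f (y n) (x n)\<close> are small wherever that sequence hardly drops.  Such a sequence cannot drop
  by \<open>1 / (k + 1)\<close> on more than \<open>c\<^sub>u * (k + 1)\<close> consecutive blocks \<open>[n, n + h n]\<close>, which is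
  what the iteration in \<open>Phi1\<close> counts (\<open>nonneg_seq_has_small_drop\<close>).  The block length
  \<open>g n + 1\<close> in \<open>Phi2\<close> covers the last difference, between \<open>n + g n\<close> and its successor.\<close>

lemma funpow_add_mono:
  fixes h :: "nat \<Rightarrow> nat"
  assumes "i \<le> j"
  shows "((\<lambda>n. n + h n) ^^ i) m \<le> ((\<lambda>n. n + h n) ^^ j) m"
  using assms by (rule lift_Suc_mono_le[rotated]) simp

text \<open>Pigeonhole: if every block starting at an iterate with index
  in \<open>{0..nat \<lceil>c * (k + 1)\<rceil>}\<close> lost at least \<open>1 / (k + 1)\<close>, the total loss would
  telescope to more than \<open>c\<close>.\<close>

lemma nonneg_seq_has_small_drop:
  fixes d :: "nat \<Rightarrow> real"
  assumes nonneg: "\<And>n. 0 \<le> d n"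
    and le_c: "d 0 \<le> c"
  shows "\<exists>n \<le> Phi1 k h c. d n - d (n + h n) < 1 / (real k + 1)"
proof (rule ccontr)
  assume no_small: "\<not> ?thesis"
  define m where "m = nat \<lceil>c * (real k + 1)\<rceil>"
  define p where "p j = ((\<lambda>n. n + h n) ^^ j) 0" for j
  have drop: "1 / (real k + 1) \<le> d (p j) - d (p (Suc j))" if "j \<le> m" for j
  proof -
    have "p j \<le> Phi1 k h c"
      unfolding Phi1_def p_def m_def[symmetric] using that by (rule funpow_add_mono)
    with no_small have "\<not> d (p j) - d (p j + h (p j)) < 1 / (real k + 1)"
      by blast
    then show ?thesis by (simp add: p_def)
  qed
  have "real (Suc m) * (1 / (real k + 1)) = (\<Sum>j<Suc m. 1 / (real k + 1))"
    by simp
  also have "\<dots> \<le> (\<Sum>j<Suc m. d (p j) - d (p (Suc j)))"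
    by (intro sum_mono drop) simp
  also have "\<dots> = d 0 - d (p (Suc m))"
    by (subst sum_lessThan_telescope') (simp add: p_def)
  also have "\<dots> \<le> c"
    using le_c nonneg[of "p (Suc m)"] by linarith
  finally have "real (Suc m) \<le> c * (real k + 1)"
    by (simp add: field_simps)
  moreover have "c * (real k + 1) \<le> real m"
    unfolding m_def by (rule real_nat_ceiling_ge)
  ultimately show False by simp
qed

lemma firmly_nonexpansive_imp_nonexpansive:
  assumes "firmly_nonexpansive T"
  shows "norm (T x - T y) \<le> norm (x - y)"
proof -
  have "norm (T x - T y) * norm (T x - T y) \<le> norm (x - y) * norm (T x - T y)"
    using assms norm_cauchy_schwarz[of "x - y" "T x - T y"]
    unfolding firmly_nonexpansive_def power2_eq_square by (meson order_trans)
  then show ?thesis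
    by (cases "norm (T x - T y) = 0") (auto simp: mult_le_cancel_right)
qed

text \<open>The cross term of the expanded square contributes \<open>- 2 * l * (h x)\<^sup>2\<close> and the quadratic
  term at most \<open>l\<^sup>2 * M\<^sup>2 * (h x)\<^sup>2\<close>; the first dominates for step sizes below \<open>2 / M\<^sup>2\<close>.\<close>

lemma subgradient_step_decrease:
  fixes h :: "'a::real_inner \<Rightarrow> real"
  assumes T: "firmly_nonexpansive T" "u \<in> Fix T"
    and subgrad: "\<xi> \<in> subdifferential h x" "norm \<xi> \<le> M"
    and signs: "0 \<le> h x" "h u \<le> 0"
    and l: "0 < a" "a \<le> l" "l \<le> b" "M\<^sup>2 * b \<le> 2"
  shows "alpha a b M * (h x)\<^sup>2
           \<le> (norm (x - u))\<^sup>2 - (norm (T (x - (l * h x) *\<^sub>R \<xi>) - u))\<^sup>2"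
proof -
  define F where "F = h x"
  have "h x + \<xi> \<bullet> (u - x) \<le> h u"
    using subgrad(1) by (simp add: subdifferential_def)
  then have toward_u: "F \<le> (x - u) \<bullet> \<xi>"
    using signs(2) by (simp add: F_def inner_diff_right inner_diff_left inner_commute)
  have sub_le: "(norm \<xi>)\<^sup>2 \<le> M\<^sup>2"
    using subgrad(2) by (intro power_mono) auto
  have "norm (T (x - (l * F) *\<^sub>R \<xi>) - T u) \<le> norm (x - (l * F) *\<^sub>R \<xi> - u)"
    by (rule firmly_nonexpansive_imp_nonexpansive[OF T(1)])
  then have "(norm (T (x - (l * F) *\<^sub>R \<xi>) - u))\<^sup>2 \<le> (norm (x - (l * F) *\<^sub>R \<xi> - u))\<^sup>2"
    using T(2) by (intro power_mono) (auto simp: Fix_def)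
  also have "x - (l * F) *\<^sub>R \<xi> - u = (x - u) - (l * F) *\<^sub>R \<xi>"
    by simp
  also have "(norm \<dots>)\<^sup>2
      = (norm (x - u))\<^sup>2 - 2 * (l * F) * ((x - u) \<bullet> \<xi>) + (l * F)\<^sup>2 * (norm \<xi>)\<^sup>2"
    by (simp only: power2_norm_eq_inner)
      (simp add: inner_diff_left inner_diff_right inner_commute algebra_simps power2_eq_square)
  also have "\<dots> \<le> (norm (x - u))\<^sup>2 - 2 * (l * F) * F + (l * F)\<^sup>2 * M\<^sup>2"
    using toward_u sub_le signs(1) l
    by (intro add_mono diff_mono mult_left_mono) (auto simp: F_def)
  also have "\<dots> = (norm (x - u))\<^sup>2 - l * (2 - M\<^sup>2 * l) * F\<^sup>2"
    by (simp add: algebra_simps power2_eq_square)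
  also have "\<dots> \<le> (norm (x - u))\<^sup>2 - alpha a b M * F\<^sup>2"
  proof -
    have "a * (2 - M\<^sup>2 * b) \<le> l * (2 - M\<^sup>2 * l)"
      using l by (intro mult_mono diff_mono mult_left_mono) auto
    then have "alpha a b M \<le> l * (2 - M\<^sup>2 * l)"
      by (simp add: alpha_def algebra_simps)
    then show ?thesis
      by (intro diff_mono mult_right_mono) auto
  qed
  finally show ?thesis
    by (simp add: F_def)
qed

text \<open>The error sought for \<open>F\<close> itself is \<open>1 / (k + 1)\<close>, so the one for \<open>A * (F n)\<^sup>2\<close> is
  \<open>A / (k + 1)\<^sup>2\<close>, which explains the argument \<open>k\<^sup>2 + 2 * k = (k + 1)\<^sup>2 - 1\<close> of \<open>Phi2\<close>.\<close>

lemma metastable_of_square_decrease: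
  fixes F d :: "nat \<Rightarrow> real"
  assumes pos: "0 < alpha a b M"
    and nonneg: "\<And>n. 0 \<le> d n"
    and le_c: "d 0 \<le> c"
    and decrease: "\<And>n. alpha a b M * (F n)\<^sup>2 \<le> d n - d (Suc n)"
  shows "\<exists>n \<le> Phi2 a b M (k\<^sup>2 + 2 * k) g c. \<forall>i\<in>{n..n + g n}. F i < 1 / (real k + 1)"
proof -
  define A where "A = alpha a b M"
  define K where "K = nat \<lceil>(real (k\<^sup>2 + 2 * k) + 1) / A\<rceil> - 1"
  have A: "0 < A" using pos by (simp add: A_def)
  have "real (k\<^sup>2 + 2 * k) + 1 = (real k + 1)\<^sup>2"
    by (simp add: power2_eq_square algebra_simps)
  then have "(real k + 1)\<^sup>2 / A \<le> real (nat \<lceil>(real (k\<^sup>2 + 2 * k) + 1) / A\<rceil>)"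
    using real_nat_ceiling_ge by simp
  also have "\<dots> \<le> real K + 1"
    unfolding K_def by linarith
  finally have K: "1 / (real K + 1) \<le> A / (real k + 1)\<^sup>2"
    using A by (simp add: field_simps)
  obtain n where n: "n \<le> Phi2 a b M (k\<^sup>2 + 2 * k) g c"
    and small: "d n - d (n + (g n + 1)) < 1 / (real K + 1)"
    using nonneg_seq_has_small_drop[of d c K "\<lambda>n. g n + 1", OF nonneg le_c]
    unfolding Phi2_def K_def A_def by blast
  have "0 \<le> d j - d (Suc j)" for j
    by (rule order_trans[OF _ decrease]) (use pos in simp)
  then have "d (Suc j) \<le> d j" for j
    by simp
  then have antimono: "d j \<le> d i" if "i \<le> j" for i j
    using that by (rule lift_Suc_antimono_le)
  have "F i < 1 / (real k + 1)" if i: "i \<in> {n..n + g n}" for i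
  proof -
    have "A * (F i)\<^sup>2 \<le> d i - d (Suc i)"
      using decrease by (simp add: A_def)
    also have "\<dots> \<le> d n - d (n + (g n + 1))"
      using i by (intro diff_mono antimono) auto
    also have "\<dots> < A * (1 / (real k + 1))\<^sup>2"
      using small K by (simp add: power_divide)
    finally have "(F i)\<^sup>2 < (1 / (real k + 1))\<^sup>2"
      using A by simp
    then show ?thesis
      by (rule power_less_imp_less_base) simp
  qed
  with n show ?thesis by blast
qed

theorem proposition7:
  fixes f :: "real ^ 'N \<Rightarrow> real ^ 'N \<Rightarrow> real"
    and T :: "real ^ 'N \<Rightarrow> real ^ 'N"
    and x y \<xi> :: "nat \<Rightarrow> real ^ 'N"
    and \<rho> \<epsilon> lam :: "nat \<Rightarrow> real"
    and u :: "real ^ 'N"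
    and a b M c\<^sub>u :: real
  assumes "\<And>z. f z z = 0"
    and "\<And>w. continuous_on UNIV (\<lambda>z. f z w)"
    and "\<And>z. convex_on UNIV (f z)"
    and "firmly_nonexpansive T"
    and "Fix T \<noteq> {}"
    and "generated_by_algorithm f T x \<rho> \<epsilon> lam y \<xi>"
    and "Omega f T y \<noteq> {}"
    and "u \<in> Omega f T y"
    and "c\<^sub>u \<ge> (norm (x 0 - u))\<^sup>2"
    and "M > 0"
    and "\<And>n. M \<ge> norm (\<xi> n)"
    and "{a..b} \<subseteq> {0<..<2 / M\<^sup>2}"
    and "\<And>n. lam n \<in> {a..b}"
  shows "\<forall>(k::nat) (g::nat \<Rightarrow> nat).
           \<exists>n \<le> Phi2 a b M (k\<^sup>2 + 2 * k) g c\<^sub>u.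
             \<forall>i\<in>{n..n + g n}. f (y i) (x i) < 1 / (real k + 1)"
proof (intro allI metastable_of_square_decrease)
  have step: "f (y n) (x n) \<ge> 0" "\<xi> n \<in> subdifferential (f (y n)) (x n)"
    "x (Suc n) = T (x n - (lam n * f (y n) (x n)) *\<^sub>R \<xi> n)" for n
    using assms(6) by (auto simp: generated_by_algorithm_def)
  have u: "u \<in> Fix T" "f (y n) u \<le> 0" for n
    using assms(8) by (auto simp: Omega_def Omega_n_def)
  have lam: "a \<le> lam n" "lam n \<le> b" for n
    using assms(13)[of n] by auto
  then have "a \<le> b"
    by (meson order_trans)
  then have a: "0 < a" and "b < 2 / M\<^sup>2"
    using assms(12) by auto
  then have Mb: "M\<^sup>2 * b < 2"
    using assms(10) by (simp add: field_simps)
  show "0 < alpha a b M"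
    using mult_pos_pos[of a "2 - M\<^sup>2 * b"] a Mb by (simp add: alpha_def algebra_simps)
  show "0 \<le> (norm (x n - u))\<^sup>2" for n
    by simp
  show "(norm (x 0 - u))\<^sup>2 \<le> c\<^sub>u"
    by (rule assms(9))
  show "alpha a b M * (f (y n) (x n))\<^sup>2 \<le> (norm (x n - u))\<^sup>2 - (norm (x (Suc n) - u))\<^sup>2" for n
    unfolding step(3)[of n]
    by (rule subgradient_step_decrease[where h = "f (y n)"])
      (use assms(4,11) step u lam a Mb in \<open>auto simp: less_imp_le\<close>)
qed

end
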